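(* Let $R$ be an explicitly given finite $\mathbb{Z}$-algebra with generators $\mathcal{G}=(g_0,\dots,g_n)$, and let $\mathrm{Rad}(0)\subseteq R$ be its nilradical. Let $e\in R$ be such that $e^2\equiv e \bmod \mathrm{Rad}(0)$. Consider the following instructions. (1) Set $h=e$. (2) Compute $f=h+r-2hr$ where $r=h^2-h$. (3) Represent $f^2-f$ as a $\mathbb{Z}$-linear combination $f^2-f=c_0g_0+\cdots+c_ng_n$ using the structure constants. (4) If $(c_0,\dots,c_n)\in\mathrm{Syz}_{\mathbb{Z}}(\mathcal{G})$, return $f$ and stop. Otherwise set $h=f$ and continue with step (2). This is an algorithm which computes an idempotent $f\in R$ such that $f\equiv e\bmod\mathrm{Rad}(0)$. Furthermore, if $e$ is a primitive idempotent modulo $\mathrm{Rad}(0)$, then $f$ is a primitive idempotent in $R$.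
   Context: All rings are commutative with $1$. A finite $\mathbb{Z}$-algebra is a $\mathbb{Z}$-algebra $R$ which is a finitely generated $\mathbb{Z}$-module; $R^+$ is its additive group. $R$ is explicitly given if it is given by generators $\mathcal{G}=(g_0,\dots,g_n)$ of $R^+$ with $g_0=1$, an integer matrix whose rows generate $\mathrm{Syz}_{\mathbb{Z}}(\mathcal{G})=\{c\in\mathbb{Z}^{n+1}\mid\sum_kc_kg_k=0\}$, and structure constants $c_{ijk}\in\mathbb{Z}$ with $g_ig_j=\sum_{k=0}^nc_{ijk}g_k$. *)

theory Defs
  imports "HOL-Algebra.Algebra" "Jordan_Normal_Form.Matrix"
begin

definition lin_comb :: "('a, 'b) ring_scheme \<Rightarrow> nat \<Rightarrow> (nat \<Rightarrow> 'a) \<Rightarrow> int vec \<Rightarrow> 'a" where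
  "lin_comb R n g v = (\<Oplus>\<^bsub>R\<^esub>k\<in>{..n}. [v $ k] \<cdot>\<^bsub>R\<^esub> g k)"

definition syz :: "('a, 'b) ring_scheme \<Rightarrow> nat \<Rightarrow> (nat \<Rightarrow> 'a) \<Rightarrow> int vec set" where
  "syz R n g = {v \<in> carrier_vec (Suc n). lin_comb R n g v = \<zero>\<^bsub>R\<^esub>}"

definition row_lattice :: "int mat \<Rightarrow> int vec set" where
  "row_lattice A = {transpose_mat A *\<^sub>v y | y. y \<in> carrier_vec (dim_row A)}"

text \<open>The zero ring is allowed, and \<open>A\<close> may have any number of rows (including none).\<close>

locale explicit_Z_algebra = cring R
  for R :: "('a, 'b) ring_scheme" (structure)
    and n :: nat and g :: "nat \<Rightarrow> 'a" and A :: "int mat"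
    and c :: "nat \<Rightarrow> nat \<Rightarrow> nat \<Rightarrow> int" +
  assumes gen_closed: "g ` {..n} \<subseteq> carrier R"
    and gen_generate: "generate (add_monoid R) (g ` {..n}) = carrier R"
    and gen_one: "g 0 = \<one>"
    and syz_dim: "dim_col A = Suc n"
    and syz_rows: "row_lattice A = syz R n g"
    and struct_consts:
      "\<And>i j. i \<le> n \<Longrightarrow> j \<le> n \<Longrightarrow> g i \<otimes> g j = (\<Oplus>k\<in>{..n}. [c i j k] \<cdot> g k)"

definition nilradical :: "('a, 'b) ring_scheme \<Rightarrow> 'a set" where
  "nilradical R = {x \<in> carrier R. \<exists>k::nat. x [^]\<^bsub>R\<^esub> k = \<zero>\<^bsub>R\<^esub>}"

definition ring_idempotent :: "('a, 'b) ring_scheme \<Rightarrow> 'a \<Rightarrow> bool" where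
  "ring_idempotent R x \<longleftrightarrow> x \<in> carrier R \<and> x \<otimes>\<^bsub>R\<^esub> x = x"

definition primitive_idempotent :: "('a, 'b) ring_scheme \<Rightarrow> 'a \<Rightarrow> bool" where
  "primitive_idempotent R x \<longleftrightarrow>
     ring_idempotent R x \<and> x \<noteq> \<zero>\<^bsub>R\<^esub> \<and>
     (\<forall>y z. ring_idempotent R y \<and> ring_idempotent R z \<and> y \<otimes>\<^bsub>R\<^esub> z = \<zero>\<^bsub>R\<^esub> \<and> x = y \<oplus>\<^bsub>R\<^esub> z
        \<longrightarrow> y = \<zero>\<^bsub>R\<^esub> \<or> z = \<zero>\<^bsub>R\<^esub>)"

text \<open>Multiplication of ring elements on the level of coefficient vectors, by means of the
  structure constants \<open>c\<close>.\<close>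

definition coeff_mult ::
    "nat \<Rightarrow> (nat \<Rightarrow> nat \<Rightarrow> nat \<Rightarrow> int) \<Rightarrow> int vec \<Rightarrow> int vec \<Rightarrow> int vec" where
  "coeff_mult n c u v = vec (Suc n) (\<lambda>k. \<Sum>i\<le>n. \<Sum>j\<le>n. u $ i * v $ j * c i j k)"

text \<open>The algorithm works on coefficient vectors and uses only the explicit data \<open>n\<close>, \<open>A\<close>, \<open>c\<close>;
  membership in the syzygy module is tested on the lattice generated by the rows of \<open>A\<close>.
  The result is \<open>None\<close> exactly if the loop does not terminate.\<close>

partial_function (option) lift_idempotent ::
    "nat \<Rightarrow> int mat \<Rightarrow> (nat \<Rightarrow> nat \<Rightarrow> nat \<Rightarrow> int) \<Rightarrow> int vec \<Rightarrow> int vec option" where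
  "lift_idempotent n A c h =
     (let r = coeff_mult n c h h - h;
          f = h + r - 2 \<cdot>\<^sub>v coeff_mult n c h r;
          s = coeff_mult n c f f - f
      in if s \<in> row_lattice A then Some f else lift_idempotent n A c f)"

end

theory Submission
  imports Defs
begin

text \<open>
  The loop is Newton's iteration for \<open>X\<^sup>2 - X\<close>, with quadratic convergence in the adic topology
  of the nilradical \<open>N\<close>: writing \<open>r = h\<^sup>2 - h\<close>, the new value \<open>f = h + r - 2hr\<close> satisfies
  \<open>f - h = r(1 - 2h)\<close> and \<open>f\<^sup>2 - f = r\<^sup>2(4r - 3)\<close> (\<open>idempotent_step_residual\<close>). Hence all iterates
  stay congruent to \<open>e\<close> modulo \<open>N\<close>, and if the \<open>2 ^ (m + 1)\<close>-th power of one residual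
  vanishes, then so does the \<open>2 ^ m\<close>-th power of the next. As the first residual is nilpotent, some
  residual vanishes (\<open>lift_idempotent_correct\<close>).

  The computation takes place on coefficient vectors, which represent ring elements only up to
  syzygies. It suffices that evaluation is additive, that it turns \<open>coeff_mult\<close> into ring
  multiplication (\<open>eval_vec_coeff_mult\<close>), and that the stopping test decides whether the evaluated
  iterate is idempotent (\<open>residual_in_row_lattice_iff\<close>).

  For primitivity, any idempotent \<open>f\<close> whose class modulo \<open>N\<close> is
  primitive is itself primitive, because \<open>0\<close> is the only nilpotent idempotent
  (\<open>primitive_idempotent_of_quotient\<close>).
\<close>

section \<open>The nilradical\<close>

context cring
begin

lemma nilradical_iff:
  "x \<in> nilradical R \<longleftrightarrow> x \<in> carrier R \<and> (\<exists>k::nat. x [^] k = \<zero>)"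
  by (simp add: nilradical_def)

lemma nat_pow_zero_mono:
  assumes "x \<in> carrier R" "x [^] (k::nat) = \<zero>" "k \<le> l"
  shows "x [^] l = \<zero>"
proof -
  have "x [^] l = x [^] k \<otimes> x [^] (l - k)"
    using assms(1,3) by (simp add: nat_pow_mult)
  then show ?thesis using assms by simp
qed

text \<open>Modulo the ideal generated by \<open>a\<close>, powers of \<open>a + b\<close> are powers of \<open>b\<close>. For nilpotent
  \<open>b\<close>, some power of \<open>a + b\<close> is thus a multiple of \<open>a\<close>; this shows that sums of nilpotents are
  nilpotent without an appeal to the binomial theorem.\<close>

lemma add_nat_pow_cong:
  assumes "a \<in> carrier R" "b \<in> carrier R"
  shows "\<exists>t\<in>carrier R. (a \<oplus> b) [^] (k::nat) = a \<otimes> t \<oplus> b [^] k"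
proof (induction k)
  case 0
  show ?case using assms by (intro bexI[of _ \<zero>]) auto
next
  case (Suc k)
  then obtain t where t: "t \<in> carrier R" "(a \<oplus> b) [^] k = a \<otimes> t \<oplus> b [^] k"
    by blast
  have "b [^] k \<in> carrier R" using assms by simp
  moreover define p where "p = b [^] k"
  ultimately have "(a \<otimes> t \<oplus> p) \<otimes> (a \<oplus> b) = a \<otimes> (t \<otimes> (a \<oplus> b) \<oplus> p) \<oplus> p \<otimes> b"
    using assms t(1) by algebra
  then have "(a \<oplus> b) [^] Suc k = a \<otimes> (t \<otimes> (a \<oplus> b) \<oplus> b [^] k) \<oplus> b [^] Suc k"
    using t(2) by (simp add: p_def)
  then show ?case
    using assms t(1) by (intro bexI[of _ "t \<otimes> (a \<oplus> b) \<oplus> b [^] k"]) auto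
qed

lemma nilradical_add_closed:
  assumes "a \<in> nilradical R" "b \<in> nilradical R"
  shows "a \<oplus> b \<in> nilradical R"
proof -
  from assms obtain m k :: nat
    where a: "a \<in> carrier R" "a [^] m = \<zero>" and b: "b \<in> carrier R" "b [^] k = \<zero>"
    by (auto simp: nilradical_iff)
  obtain t where t: "t \<in> carrier R" "(a \<oplus> b) [^] k = a \<otimes> t"
    using add_nat_pow_cong[OF a(1) b(1), of k] a b by auto
  have "(a \<oplus> b) [^] (k * m) = (a \<otimes> t) [^] m"
    using a b t by (simp add: nat_pow_pow[symmetric])
  also have "\<dots> = \<zero>"
    using a t by (simp add: nat_pow_distrib)
  finally show ?thesis using a b by (auto simp: nilradical_iff)
qed

lemma nilradical_mult_closed:
  assumes "a \<in> nilradical R" "x \<in> carrier R"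
  shows "a \<otimes> x \<in> nilradical R"
proof -
  from assms obtain m :: nat where "a \<in> carrier R" "a [^] m = \<zero>"
    by (auto simp: nilradical_iff)
  then have "(a \<otimes> x) [^] m = \<zero>"
    using assms(2) by (simp add: nat_pow_distrib)
  then show ?thesis using \<open>a \<in> carrier R\<close> assms(2) by (auto simp: nilradical_iff)
qed

lemma nilradical_ideal: "ideal (nilradical R) R"
proof (rule idealI)
  show "subgroup (nilradical R) (add_monoid R)"
  proof (rule add.subgroupI)
    show "nilradical R \<subseteq> carrier R" by (auto simp: nilradical_iff)
    have "\<zero> [^] (1::nat) = \<zero>" by simp
    then show "nilradical R \<noteq> {}" using nilradical_iff zero_closed by blast
    show "\<ominus> a \<in> nilradical R" if "a \<in> nilradical R" for a
    proof -
      have "\<ominus> a = a \<otimes> \<ominus> \<one>" using that by (simp add: nilradical_iff r_minus)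
      then show ?thesis using nilradical_mult_closed[OF that, of "\<ominus> \<one>"] by simp
    qed
  qed (use nilradical_add_closed in auto)
next
  fix a x assume a: "a \<in> nilradical R" and x: "x \<in> carrier R"
  show 1: "a \<otimes> x \<in> nilradical R" using a x by (rule nilradical_mult_closed)
  show "x \<otimes> a \<in> nilradical R" using 1 a x by (simp add: m_comm nilradical_iff)
qed (rule ring_axioms)

lemma idempotent_nilpotent_eq_zero:
  assumes "ring_idempotent R x" "x \<in> nilradical R"
  shows "x = \<zero>"
proof -
  obtain k :: nat where k: "x [^] k = \<zero>" using assms(2) by (auto simp: nilradical_iff)
  have x: "x \<in> carrier R" "x \<otimes> x = x" using assms(1) by (auto simp: ring_idempotent_def)
  have "x [^] Suc l = x" for l :: nat
    using x by (induction l) auto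
  then show ?thesis using nat_pow_zero_mono[OF x(1) k, of "Suc k"] by simp
qed

text \<open>A splitting of \<open>f\<close> into orthogonal idempotents induces one of its class modulo the
  nilradical, and a summand that becomes zero there was already zero, being both idempotent and
  nilpotent.\<close>

lemma primitive_idempotent_of_quotient:
  assumes f: "ring_idempotent R f"
    and prim: "primitive_idempotent (R Quot nilradical R) (nilradical R +> f)"
  shows "primitive_idempotent R f"
proof -
  let ?N = "nilradical R" and ?Q = "R Quot nilradical R"
  interpret N: ideal ?N R by (rule nilradical_ideal)
  note hom_closed = ring_hom_closed[OF N.rcos_ring_hom]
    and hom_add = ring_hom_add[OF N.rcos_ring_hom]
    and hom_mult = ring_hom_mult[OF N.rcos_ring_hom]
  have zero_Q: "\<zero>\<^bsub>?Q\<^esub> = ?N"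
    by (simp add: FactRing_def)
  have hom_zero: "?N +> \<zero> = \<zero>\<^bsub>?Q\<^esub>"
    unfolding zero_Q by (rule N.a_rcos_const) (rule N.zero_closed)
  have zero: "x = \<zero>" if x: "ring_idempotent R x" and x0: "?N +> x = \<zero>\<^bsub>?Q\<^esub>" for x
  proof (rule idempotent_nilpotent_eq_zero[OF x])
    show "x \<in> ?N"
      using x x0 unfolding ring_idempotent_def zero_Q by (blast intro: N.rcos_const_imp_mem)
  qed
  have idem: "ring_idempotent ?Q (?N +> x)" if "ring_idempotent R x" for x
    using that hom_mult[of x x] hom_closed[of x] by (simp add: ring_idempotent_def)
  have "f \<noteq> \<zero>"
    using prim hom_zero by (auto simp: primitive_idempotent_def)
  moreover have "y = \<zero> \<or> z = \<zero>"
    if y: "ring_idempotent R y" and z: "ring_idempotent R z"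
      and yz: "y \<otimes> z = \<zero>" "f = y \<oplus> z" for y z
  proof -
    have c: "y \<in> carrier R" "z \<in> carrier R" using y z by (auto simp: ring_idempotent_def)
    have "(?N +> y) \<otimes>\<^bsub>?Q\<^esub> (?N +> z) = \<zero>\<^bsub>?Q\<^esub>"
      using hom_mult[OF c] hom_zero unfolding yz(1) by metis
    moreover have "?N +> f = (?N +> y) \<oplus>\<^bsub>?Q\<^esub> (?N +> z)"
      unfolding yz(2) using c by (rule hom_add)
    ultimately have "?N +> y = \<zero>\<^bsub>?Q\<^esub> \<or> ?N +> z = \<zero>\<^bsub>?Q\<^esub>"
      using prim idem[OF y] idem[OF z] unfolding primitive_idempotent_def by blast
    then show ?thesis using zero y z by blast
  qed
  ultimately show ?thesis
    using f unfolding primitive_idempotent_def by blast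
qed

section \<open>One step of the iteration\<close>

text \<open>With \<open>q = 1 - 2h\<close> one has \<open>q\<^sup>2 = 1 + 4r\<close>, hence
  \<open>f\<^sup>2 - f = (h + rq)\<^sup>2 - (h + rq) = r - rq\<^sup>2 + r\<^sup>2q\<^sup>2 = r\<^sup>2(4r - 3)\<close>: the step is the Newton step
  for \<open>X\<^sup>2 - X\<close>, with the derivative \<open>-q\<close> used as its own inverse, which is correct modulo \<open>r\<close>.\<close>

lemma idempotent_step_residual:
  assumes h: "h \<in> carrier R" and r: "r = h \<otimes> h \<ominus> h"
    and f: "f = (h \<oplus> r) \<ominus> (h \<otimes> r \<oplus> h \<otimes> r)"
  shows "f \<otimes> f \<ominus> f = (r \<otimes> r) \<otimes> ((r \<oplus> r \<oplus> r \<oplus> r) \<ominus> (\<one> \<oplus> \<one> \<oplus> \<one>))"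
proof -
  define q where "q = \<one> \<ominus> (h \<oplus> h)"
  have rR: "r \<in> carrier R" and qR: "q \<in> carrier R" using h by (simp_all add: r q_def)
  have q_sq: "q \<otimes> q = \<one> \<oplus> (r \<oplus> r \<oplus> r \<oplus> r)"
    unfolding q_def r using h by algebra
  have "f = h \<oplus> r \<otimes> q"
    unfolding f q_def using h rR by algebra
  then have "f \<otimes> f \<ominus> f = (h \<otimes> h \<ominus> h) \<ominus> r \<otimes> (\<one> \<ominus> (h \<oplus> h)) \<otimes> q \<oplus> r \<otimes> r \<otimes> (q \<otimes> q)"
    using h rR qR by algebra
  also have "\<dots> = r \<ominus> r \<otimes> (q \<otimes> q) \<oplus> r \<otimes> r \<otimes> (q \<otimes> q)"
    using rR qR by (simp add: m_assoc flip: r q_def)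
  also have "\<dots> = (r \<otimes> r) \<otimes> ((r \<oplus> r \<oplus> r \<oplus> r) \<ominus> (\<one> \<oplus> \<one> \<oplus> \<one>))"
    unfolding q_sq using rR by algebra
  finally show ?thesis .
qed

lemma idempotent_step_diff:
  assumes "h \<in> carrier R" "r \<in> carrier R"
  shows "((h \<oplus> r) \<ominus> (h \<otimes> r \<oplus> h \<otimes> r)) \<ominus> h = r \<otimes> (\<one> \<ominus> (h \<oplus> h))"
  using assms by algebra

end

section \<open>Arithmetic on coefficient vectors\<close>

context explicit_Z_algebra
begin

abbreviation eval_vec :: "int vec \<Rightarrow> 'a" where
  "eval_vec \<equiv> lin_comb R n g"

lemma gen_in_carrier: "k \<le> n \<Longrightarrow> g k \<in> carrier R"
  using gen_closed by auto

lemma eval_vec_closed: "eval_vec v \<in> carrier R"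
  unfolding lin_comb_def by (rule finsum_closed) (auto simp: gen_in_carrier)

lemma eval_vec_add:
  assumes "u \<in> carrier_vec (Suc n)" "v \<in> carrier_vec (Suc n)"
  shows "eval_vec (u + v) = eval_vec u \<oplus> eval_vec v"
proof -
  have "eval_vec (u + v) = (\<Oplus>k\<in>{..n}. add_pow R (u $ k) (g k) \<oplus> add_pow R (v $ k) (g k))"
    unfolding lin_comb_def
    using assms by (intro finsum_cong') (auto simp: gen_in_carrier add.int_pow_mult)
  also have "\<dots> = eval_vec u \<oplus> eval_vec v"
    unfolding lin_comb_def by (rule finsum_addf) (auto simp: gen_in_carrier)
  finally show ?thesis .
qed

lemma eval_vec_zero: "eval_vec (0\<^sub>v (Suc n)) = \<zero>"
proof -
  have "eval_vec (0\<^sub>v (Suc n)) = (\<Oplus>k\<in>{..n}. \<zero>)"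
    unfolding lin_comb_def by (intro finsum_cong') (auto simp: add_pow_int_ge)
  then show ?thesis by simp
qed

lemma eval_vec_diff:
  assumes "u \<in> carrier_vec (Suc n)" "v \<in> carrier_vec (Suc n)"
  shows "eval_vec (u - v) = eval_vec u \<ominus> eval_vec v"
proof -
  have "u = (u - v) + v" using assms by auto
  then have "eval_vec u = eval_vec (u - v) \<oplus> eval_vec v"
    using eval_vec_add[of "u - v" v] assms by simp
  moreover have "x \<oplus> y \<ominus> y = x" if "x \<in> carrier R" "y \<in> carrier R" for x y
    using that by algebra
  ultimately show ?thesis by (simp add: eval_vec_closed)
qed

lemma eval_vec_two:
  assumes "u \<in> carrier_vec (Suc n)"
  shows "eval_vec (2 \<cdot>\<^sub>v u) = eval_vec u \<oplus> eval_vec u"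
proof -
  have "2 \<cdot>\<^sub>v u = u + u" using assms by auto
  then show ?thesis using assms by (simp add: eval_vec_add)
qed

lemma eval_vec_sum:
  assumes "finite I"
  shows "eval_vec (vec (Suc n) (\<lambda>k. \<Sum>i\<in>I. w i k)) = (\<Oplus>i\<in>I. eval_vec (vec (Suc n) (w i)))"
  using assms
proof (induction I)
  case empty
  show ?case by (simp add: eval_vec_zero flip: zero_vec_def)
next
  case (insert i I)
  have "vec (Suc n) (\<lambda>k. \<Sum>i\<in>insert i I. w i k)
      = vec (Suc n) (w i) + vec (Suc n) (\<lambda>k. \<Sum>i\<in>I. w i k)"
    using insert.hyps by auto
  then show ?case
    using insert by (simp add: eval_vec_add eval_vec_closed)
qed

lemma eval_vec_scale:
  "eval_vec (vec (Suc n) (\<lambda>k. m * w k)) = add_pow R m (eval_vec (vec (Suc n) w))"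
proof -
  \<comment> \<open>Writing the scalar \<open>m\<close> as the ring element \<open>m \<cdot> 1\<close> reduces the claim to distributivity.\<close>
  have "eval_vec (vec (Suc n) (\<lambda>k. m * w k)) = (\<Oplus>k\<in>{..n}. (add_pow R m \<one>) \<otimes> (add_pow R (w k) (g k)))"
    unfolding lin_comb_def
    by (intro finsum_cong')
       (auto simp: gen_in_carrier add_pow_ldistr_int add.int_pow_pow mult.commute)
  also have "\<dots> = (add_pow R m \<one>) \<otimes> (\<Oplus>k\<in>{..n}. add_pow R (w k) (g k))"
    by (rule finsum_rdistr[symmetric]) (auto simp: gen_in_carrier)
  also have "(\<Oplus>k\<in>{..n}. add_pow R (w k) (g k)) = eval_vec (vec (Suc n) w)"
    unfolding lin_comb_def by (intro finsum_cong') (auto simp: gen_in_carrier)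
  finally show ?thesis by (simp add: add_pow_ldistr_int eval_vec_closed)
qed

lemma coeff_mult_carrier: "coeff_mult n c u v \<in> carrier_vec (Suc n)"
  by (simp add: coeff_mult_def)

lemma eval_vec_coeff_mult: "eval_vec (coeff_mult n c u v) = eval_vec u \<otimes> eval_vec v"
proof -
  have struct: "eval_vec (vec (Suc n) (c i j)) = g i \<otimes> g j" if "i \<le> n" "j \<le> n" for i j
    unfolding lin_comb_def struct_consts[OF that]
    by (intro finsum_cong') (auto simp: gen_in_carrier)
  have "eval_vec (coeff_mult n c u v)
      = (\<Oplus>i\<in>{..n}. \<Oplus>j\<in>{..n}. add_pow R (u $ i * v $ j) (eval_vec (vec (Suc n) (c i j))))"
    unfolding coeff_mult_def by (simp add: eval_vec_sum eval_vec_scale)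
  also have "\<dots> = (\<Oplus>i\<in>{..n}. \<Oplus>j\<in>{..n}. (add_pow R (u $ i) (g i)) \<otimes> (add_pow R (v $ j) (g j)))"
    by (intro finsum_cong' refl)
       (auto simp: gen_in_carrier struct add_pow_ldistr_int add_pow_rdistr_int add.int_pow_pow
          mult.commute intro!: finsum_closed finsum_cong')
  also have "\<dots> = (\<Oplus>i\<in>{..n}. (add_pow R (u $ i) (g i)) \<otimes> eval_vec v)"
    unfolding lin_comb_def
    by (intro finsum_cong' refl finsum_rdistr[symmetric])
       (auto simp: gen_in_carrier intro!: finsum_closed)
  also have "\<dots> = eval_vec u \<otimes> eval_vec v"
    unfolding lin_comb_def[of R n g u]
    by (rule finsum_ldistr[symmetric]) (auto simp: gen_in_carrier eval_vec_closed)
  finally show ?thesis .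
qed

text \<open>Coefficient vectors of zero are exactly the syzygies, which the rows of \<open>A\<close> generate; so the
  stopping test depends only on the ring element, not on the vector chosen to represent it.\<close>

lemma in_row_lattice_iff:
  "v \<in> carrier_vec (Suc n) \<Longrightarrow> v \<in> row_lattice A \<longleftrightarrow> eval_vec v = \<zero>"
  by (simp add: syz_rows syz_def)

section \<open>Termination and correctness of the iteration\<close>

definition step_vec :: "int vec \<Rightarrow> int vec" where
  "step_vec h = (let r = coeff_mult n c h h - h in h + r - 2 \<cdot>\<^sub>v coeff_mult n c h r)"

lemma lift_idempotent_unfold:
  "lift_idempotent n A c h =
    (let f = step_vec h in
     if coeff_mult n c f f - f \<in> row_lattice A then Some f else lift_idempotent n A c f)"
  by (subst lift_idempotent.simps) (simp add: step_vec_def Let_def)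

lemma step_vec_carrier: "h \<in> carrier_vec (Suc n) \<Longrightarrow> step_vec h \<in> carrier_vec (Suc n)"
  by (simp add: step_vec_def Let_def coeff_mult_carrier)

lemma eval_step_vec:
  assumes "h \<in> carrier_vec (Suc n)"
  defines "x \<equiv> eval_vec h"
  defines "r \<equiv> x \<otimes> x \<ominus> x"
  shows "eval_vec (step_vec h) = (x \<oplus> r) \<ominus> (x \<otimes> r \<oplus> x \<otimes> r)"
  using assms(1) unfolding step_vec_def Let_def x_def r_def
  by (simp add: eval_vec_add eval_vec_diff eval_vec_two eval_vec_coeff_mult coeff_mult_carrier)

lemma residual_in_row_lattice_iff:
  assumes "f \<in> carrier_vec (Suc n)"
  shows "coeff_mult n c f f - f \<in> row_lattice A \<longleftrightarrow> ring_idempotent R (eval_vec f)"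
proof -
  have "x \<otimes> x \<ominus> x = \<zero> \<longleftrightarrow> x \<otimes> x = x" if "x \<in> carrier R" for x
    using that by simp
  then show ?thesis
    using assms eval_vec_closed[of f]
    by (simp add: in_row_lattice_iff eval_vec_diff coeff_mult_carrier eval_vec_coeff_mult
        ring_idempotent_def)
qed

text \<open>By \<open>idempotent_step_residual\<close>, one step replaces the residual \<open>r\<close> by a multiple of \<open>r\<^sup>2\<close>, so
  that the bound \<open>2 ^ m\<close> on its nilpotency index is halved. For \<open>m = 0\<close> the residual is already
  zero, and the first step returns.\<close>

lemma lift_idempotent_correct:
  assumes "a \<in> carrier_vec (Suc n)"
    and "(eval_vec a \<otimes> eval_vec a \<ominus> eval_vec a) [^] ((2::nat) ^ m) = \<zero>"
  shows "\<exists>v. lift_idempotent n A c a = Some v \<and> v \<in> carrier_vec (Suc n) \<and>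
    ring_idempotent R (eval_vec v) \<and> eval_vec v \<ominus> eval_vec a \<in> nilradical R"
  using assms
proof (induction m arbitrary: a)
  case (0 a)
  let ?f = "step_vec a"
  define x where "x = eval_vec a"
  define r where "r = x \<otimes> x \<ominus> x"
  have x: "x \<in> carrier R" by (simp add: x_def eval_vec_closed)
  have "r = \<zero>" using 0(2) x by (simp add: r_def x_def)
  then have f: "eval_vec ?f = x"
    using eval_step_vec[OF 0(1), folded x_def, folded r_def] x by (simp add: minus_eq)
  have "ring_idempotent R x" using \<open>r = \<zero>\<close> x by (simp add: r_def ring_idempotent_def)
  moreover have "x \<ominus> x \<in> nilradical R"
    using x additive_subgroup.zero_closed[OF ideal.axioms(1)[OF nilradical_ideal]]
    by (simp add: r_neg minus_eq)
  ultimately show ?case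
    using f residual_in_row_lattice_iff[OF step_vec_carrier[OF 0(1)]] step_vec_carrier[OF 0(1)]
    by (subst lift_idempotent_unfold) (simp add: x_def)
next
  case (Suc m a)
  let ?f = "step_vec a"
  define x where "x = eval_vec a"
  define r where "r = x \<otimes> x \<ominus> x"
  define y where "y = eval_vec ?f"
  have x: "x \<in> carrier R" and y: "y \<in> carrier R" by (simp_all add: x_def y_def eval_vec_closed)
  then have r: "r \<in> carrier R" by (simp add: r_def)
  have f: "?f \<in> carrier_vec (Suc n)" using Suc.prems(1) by (rule step_vec_carrier)
  have y_eq: "y = (x \<oplus> r) \<ominus> (x \<otimes> r \<oplus> x \<otimes> r)"
    using eval_step_vec[OF Suc.prems(1)] by (simp add: x_def r_def y_def)
  have r_pow: "r [^] ((2::nat) ^ Suc m) = \<zero>" using Suc.prems(2) by (simp add: r_def x_def)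
  then have "r \<in> nilradical R" using r by (auto simp: nilradical_iff)
  then have yx: "y \<ominus> x \<in> nilradical R"
    unfolding y_eq using x r by (simp add: idempotent_step_diff nilradical_mult_closed)
  show ?case
  proof (cases "ring_idempotent R y")
    case True
    then show ?thesis
      using f yx residual_in_row_lattice_iff[OF f]
      by (subst lift_idempotent_unfold) (simp add: y_def x_def)
  next
    case False
    define t where "t = (r \<oplus> r \<oplus> r \<oplus> r) \<ominus> (\<one> \<oplus> \<one> \<oplus> \<one>)"
    have t: "t \<in> carrier R" "y \<otimes> y \<ominus> y = (r \<otimes> r) \<otimes> t"
      using idempotent_step_residual[OF x r_def y_eq] r by (simp_all add: t_def)
    have "(r \<otimes> r) [^] ((2::nat) ^ m) = r [^] ((2::nat) ^ Suc m)"
      using r by (simp add: nat_pow_distrib nat_pow_mult mult_2)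
    then have "(y \<otimes> y \<ominus> y) [^] ((2::nat) ^ m) = \<zero>"
      using t r r_pow by (simp add: nat_pow_distrib)
    then obtain v where v: "lift_idempotent n A c ?f = Some v" "v \<in> carrier_vec (Suc n)"
      "ring_idempotent R (eval_vec v)" "eval_vec v \<ominus> y \<in> nilradical R"
      using Suc.IH[OF f] by (auto simp: y_def)
    have "eval_vec v \<ominus> x = (eval_vec v \<ominus> y) \<oplus> (y \<ominus> x)"
      using x y eval_vec_closed[of v] by algebra
    then have "eval_vec v \<ominus> x \<in> nilradical R"
      using nilradical_add_closed[OF v(4) yx] by simp
    then show ?thesis
      using v False residual_in_row_lattice_iff[OF f]
      by (subst lift_idempotent_unfold) (simp add: y_def x_def)
  qed
qed

end

theorem mainTheorem9:
  fixes R :: "('a, 'b) ring_scheme" and n :: nat and g :: "nat \<Rightarrow> 'a" and A :: "int mat"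
    and c :: "nat \<Rightarrow> nat \<Rightarrow> nat \<Rightarrow> int" and e :: 'a and a :: "int vec"
  assumes "explicit_Z_algebra R n g A c"
    and "e \<in> carrier R"
    and "e \<otimes>\<^bsub>R\<^esub> e \<ominus>\<^bsub>R\<^esub> e \<in> nilradical R"
    and "a \<in> carrier_vec (Suc n)" and "e = lin_comb R n g a"
  shows "\<exists>v f. lift_idempotent n A c a = Some v \<and> v \<in> carrier_vec (Suc n) \<and> f = lin_comb R n g v \<and>
    ring_idempotent R f \<and> f \<ominus>\<^bsub>R\<^esub> e \<in> nilradical R \<and>
    (primitive_idempotent (R Quot nilradical R) (nilradical R +>\<^bsub>R\<^esub> e) \<longrightarrow> primitive_idempotent R f)"
proof -
  interpret explicit_Z_algebra R n g A c by fact
  obtain k :: nat where k: "(e \<otimes>\<^bsub>R\<^esub> e \<ominus>\<^bsub>R\<^esub> e) [^]\<^bsub>R\<^esub> k = \<zero>\<^bsub>R\<^esub>"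
    using assms(3) by (auto simp: nilradical_iff)
  have "e \<otimes>\<^bsub>R\<^esub> e \<ominus>\<^bsub>R\<^esub> e \<in> carrier R"
    using assms(2) by simp
  from nat_pow_zero_mono[OF this k less_imp_le[OF less_exp]]
  have "(e \<otimes>\<^bsub>R\<^esub> e \<ominus>\<^bsub>R\<^esub> e) [^]\<^bsub>R\<^esub> ((2::nat) ^ k) = \<zero>\<^bsub>R\<^esub>" .
  then obtain v where v: "lift_idempotent n A c a = Some v" "v \<in> carrier_vec (Suc n)"
    "ring_idempotent R (eval_vec v)" "eval_vec v \<ominus>\<^bsub>R\<^esub> e \<in> nilradical R"
    using lift_idempotent_correct[OF assms(4), of k] assms(5) by auto
  have "nilradical R +>\<^bsub>R\<^esub> eval_vec v = nilradical R +>\<^bsub>R\<^esub> e"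
    using quotient_eq_iff_same_a_r_cos[OF nilradical_ideal] v(4) assms(2) eval_vec_closed
    by blast
  then show ?thesis
    using v primitive_idempotent_of_quotient by auto
qed

end
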